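(* Let $N\ge1$, $0<p<1$, $\mu<\frac14$, $\mu\ne0$, and $\beta_-=\frac12-\sqrt{\frac14-\mu}$. Suppose that $u$ is a radial solution of $\Delta u+\frac{\mu}{\delta^2}u=u^p$ which exists and is positive up to the outer boundary $r=R$ of a ball or annulus, or up to the inner boundary $r=r_0>0$ of an annulus. Then $\frac{u(\delta)}{\delta^{\beta_-}}$ converges to a finite limit $v(0)$ as $\delta\to0$.
   Context: The ball is $B_R=\{|x|<R\}\subset\mathbb{R}^N$, the annulus is $\{r_0<|x|<R\}$, and $\delta$ is the distance to the boundary: $\delta=R-r$ near the outer boundary, $\delta=r-r_0$ near the inner boundary, $r=|x|$. Radial solutions satisfy $u''+\frac{N-1}{r}u'+\frac{\mu}{\delta^2}u=u^p$ (derivatives in $r$). "Exists and is positive up to the boundary" means that $u$ is defined and positive for $0<\delta<\delta_0$ for some $\delta_0>0$; $u$ is regarded as a function of $\delta$. *)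

theory Defs
  imports "HOL-Analysis.Analysis"
begin

definition partial_deriv :: "'a::euclidean_space \<Rightarrow> ('a \<Rightarrow> real) \<Rightarrow> 'a \<Rightarrow> real" where
  "partial_deriv i f x = deriv (\<lambda>t. f (x + t *\<^sub>R i)) 0"

text \<open>\<open>C1_on\<close> and \<open>C2_on\<close> are meant for open sets \<open>S\<close>, where having continuous partial
  derivatives up to the given order is the usual class of continuously differentiable functions.\<close>

definition C1_on :: "'a::euclidean_space set \<Rightarrow> ('a \<Rightarrow> real) \<Rightarrow> bool" where
  "C1_on S f \<longleftrightarrow> (\<forall>i\<in>Basis.
     (\<forall>x\<in>S. (\<lambda>t. f (x + t *\<^sub>R i)) field_differentiable (at 0)) \<and>
     continuous_on S (partial_deriv i f))"

definition C2_on :: "'a::euclidean_space set \<Rightarrow> ('a \<Rightarrow> real) \<Rightarrow> bool" where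
  "C2_on S f \<longleftrightarrow> C1_on S f \<and> (\<forall>i\<in>Basis. C1_on S (partial_deriv i f))"

definition laplacian :: "('a::euclidean_space \<Rightarrow> real) \<Rightarrow> 'a \<Rightarrow> real" where
  "laplacian f x = (\<Sum>i\<in>Basis. partial_deriv i (partial_deriv i f) x)"

definition annulus :: "real \<Rightarrow> real \<Rightarrow> 'a::euclidean_space set" where
  "annulus r0 R = {x. r0 < norm x \<and> norm x < R}"

text \<open>A classical solution on \<open>S \<subseteq> \<Omega>\<close> of \<open>\<Delta>U + \<mu>/\<delta>\<^sup>2 U = U\<^sup>p\<close>, where \<open>\<delta>\<close> is the distance to the
  boundary of the whole domain \<open>\<Omega>\<close>. It is only used for functions that are positive on \<open>S\<close>.\<close>

definition solution_on ::
    "'a::euclidean_space set \<Rightarrow> 'a set \<Rightarrow> real \<Rightarrow> real \<Rightarrow> ('a \<Rightarrow> real) \<Rightarrow> bool" where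
  "solution_on \<Omega> S \<mu> p U \<longleftrightarrow> C2_on S U \<and>
     (\<forall>x\<in>S. laplacian U x + \<mu> / (infdist x (frontier \<Omega>))\<^sup>2 * U x = U x powr p)"

text \<open>The radial function with profile \<open>u\<close> (a function of \<open>r = |x|\<close>) is a positive solution up to
  the boundary component \<open>|x| = s\<close> of \<open>\<Omega>\<close>. It need only be a solution close to that component,
  so \<open>u\<close> may be arbitrary elsewhere.\<close>

definition positive_radial_solution_up_to ::
    "'a::euclidean_space set \<Rightarrow> real \<Rightarrow> real \<Rightarrow> real \<Rightarrow> (real \<Rightarrow> real) \<Rightarrow> bool" where
  "positive_radial_solution_up_to \<Omega> s \<mu> p u \<longleftrightarrow> (\<exists>\<delta>0>0.
     let S = {x\<in>\<Omega>. \<bar>norm x - s\<bar> < \<delta>0} in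
       solution_on \<Omega> S \<mu> p (\<lambda>x. u (norm x)) \<and> (\<forall>x\<in>S. 0 < u (norm x)))"

end

theory Submission imports Defs begin

text \<open>With \<open>v = u / \<delta>\<^sup>\<beta>\<close>, \<open>w = \<delta> v'\<close> and \<open>\<lambda> = 1 - 2\<beta> > 0\<close> the radial equation becomes
  \<open>v' = w / \<delta>\<close>, \<open>w' = \<lambda> w / \<delta> + e\<close>, where \<open>|e|\<close> is at most linear in \<open>(v, w)\<close>: this uses
  \<open>v\<^sup>p \<le> 1 + v\<close> and \<open>\<beta> (1 - p) \<le> 1\<close>. The combination \<open>z = v - w / \<lambda>\<close> satisfies
  \<open>z' = - e / \<lambda>\<close>, without the singular term, and in \<open>z\<^sup>2 + w\<^sup>2 + 1\<close> the singular term only contributes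
  growth in \<open>\<delta>\<close>. Gronwall's argument towards \<open>\<delta> = 0\<close> therefore bounds \<open>z\<close>, \<open>w\<close> and \<open>e\<close>; hence \<open>z\<close> is
  Lipschitz and converges, \<open>w\<close> tends to \<open>0\<close>, and \<open>v = z + w / \<lambda>\<close> converges.\<close>

section \<open>A priori bounds and limits for a perturbed Euler system\<close>

lemma perturbed_euler_system_limit:
  fixes z w e :: "real \<Rightarrow> real"
  assumes "0 < c" and lam: "0 < lam"
    and dz: "\<And>t. 0 < t \<Longrightarrow> t < c \<Longrightarrow> (z has_real_derivative - e t / lam) (at t)"
    and dw: "\<And>t. 0 < t \<Longrightarrow> t < c \<Longrightarrow> (w has_real_derivative lam * w t / t + e t) (at t)"
    and e: "\<And>t. 0 < t \<Longrightarrow> t < c \<Longrightarrow> \<bar>e t\<bar> \<le> K * (\<bar>z t\<bar> + \<bar>w t\<bar> + 1)"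
  shows "(\<exists>z0. (z \<longlongrightarrow> z0) (at_right 0)) \<and> (w \<longlongrightarrow> 0) (at_right 0)"
proof -
  define a where "a = c / 2"
  have a: "0 < a" "a < c"
    using \<open>0 < c\<close> by (auto simp: a_def)
  have "0 \<le> K * (\<bar>z a\<bar> + \<bar>w a\<bar> + 1)"
    using e[of a] a by linarith
  then have K: "0 \<le> K"
    by (smt (verit) mult_less_0_iff)
  \<comment> \<open>With \<open>m = |z| + |w| + 1\<close>, both \<open>|z e|\<close> and
    \<open>|w e|\<close> are at most \<open>K m^2\<close>, hence at most \<open>3 K Q\<close>. The
    derivative of \<open>Q\<close> contains \<open>z e / lam\<close> and \<open>w e\<close> twice
    each, which gives this constant.\<close>
  define C where "C = 6 * K * (1 / lam + 1)"
  define Q where "Q t = (z t)\<^sup>2 + (w t)\<^sup>2 + 1" for t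
  define Q' where "Q' t = 2 * z t * (- e t / lam) + 2 * w t * (lam * w t / t + e t)" for t
  have sum3: "(x + y + 1)\<^sup>2 \<le> 3 * (x\<^sup>2 + y\<^sup>2 + 1)" for x y :: real
  proof -
    have "0 \<le> (x - y)\<^sup>2 + (x - 1)\<^sup>2 + (y - 1)\<^sup>2" by simp
    then show ?thesis by (simp add: power2_eq_square algebra_simps)
  qed
  have dQ: "(Q has_real_derivative Q' t) (at t)" if "0 < t" "t < c" for t
    unfolding Q_def Q'_def
    by (auto intro!: derivative_eq_intros dz dw that)
  have Q'_ge: "- C * Q t \<le> Q' t" if t: "0 < t" "t < c" for t
  proof -
    define m where "m = \<bar>z t\<bar> + \<bar>w t\<bar> + 1"
    have m: "\<bar>z t\<bar> \<le> m" "\<bar>w t\<bar> \<le> m" "0 \<le> m" "\<bar>e t\<bar> \<le> K * m"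
      using e[OF t] by (auto simp: m_def)
    have "m\<^sup>2 \<le> 3 * Q t"
      using sum3[of "\<bar>z t\<bar>" "\<bar>w t\<bar>"] by (simp add: m_def Q_def)
    moreover have "\<bar>z t * e t\<bar> \<le> K * m\<^sup>2" "\<bar>w t * e t\<bar> \<le> K * m\<^sup>2"
      using mult_mono[OF m(1) m(4)] mult_mono[OF m(2) m(4)] m K
      by (auto simp: abs_mult power2_eq_square algebra_simps)
    ultimately have "\<bar>z t * e t\<bar> \<le> 3 * K * Q t" "\<bar>w t * e t\<bar> \<le> 3 * K * Q t"
      using mult_left_mono[OF \<open>m\<^sup>2 \<le> 3 * Q t\<close> K] by auto
    then have "z t * e t / lam \<le> 3 * K * Q t / lam" "- (3 * K * Q t) \<le> w t * e t"
      using lam by (auto intro!: divide_right_mono)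
    moreover have "0 \<le> lam * (w t)\<^sup>2 / t"
      using lam t by simp
    ultimately have "0 \<le> 2 * (3 * K * Q t / lam - z t * e t / lam)
        + 2 * (3 * K * Q t + w t * e t) + 2 * (lam * (w t)\<^sup>2 / t)"
      by (intro add_nonneg_nonneg) auto
    also have "\<dots> = Q' t + C * Q t"
      unfolding Q'_def C_def by (simp add: algebra_simps power2_eq_square)
    finally show ?thesis by simp
  qed
  \<comment> \<open>Gronwall run backwards: \<open>exp (C * t) * Q t\<close> is nondecreasing, so
    its value at \<open>a\<close> controls it down to 0, and the factor \<open>exp (C * t)\<close>
    is at least 1.\<close>
  have Qbound: "Q t \<le> exp (C * a) * Q a" if t: "0 < t" "t \<le> a" for t
  proof -
    have "exp (C * t) * Q t \<le> exp (C * a) * Q a"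
    proof (rule DERIV_nonneg_imp_nondecreasing[OF t(2)])
      fix x assume x: "t \<le> x" "x \<le> a"
      then have x': "0 < x" "x < c" using t a by auto
      have "((\<lambda>t. exp (C * t) * Q t) has_real_derivative exp (C * x) * (C * Q x + Q' x)) (at x)"
        by (auto intro!: derivative_eq_intros dQ x' simp: algebra_simps)
      moreover have "0 \<le> exp (C * x) * (C * Q x + Q' x)"
        using Q'_ge[OF x'] by simp
      ultimately show "\<exists>y. ((\<lambda>t. exp (C * t) * Q t) has_real_derivative y) (at x) \<and> 0 \<le> y"
        by blast
    qed
    moreover have "0 \<le> C * t" "0 \<le> Q t"
      using K lam t by (auto simp: C_def Q_def)
    then have "Q t \<le> exp (C * t) * Q t"
      by (simp add: mult_le_cancel_right1)
    ultimately show ?thesis by linarith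
  qed
  define M where "M = exp (C * a) * Q a"
  define E where "E = K * (2 * M + 1)"
  have sq: "\<bar>x\<bar> \<le> x\<^sup>2 + 1" for x :: real
    using sum_squares_ge_zero[of "\<bar>x\<bar> - 1" 0] by (auto simp: power2_eq_square algebra_simps abs_if)
  have zw: "\<bar>z t\<bar> \<le> M" "\<bar>w t\<bar> \<le> M" if t: "0 < t" "t \<le> a" for t
    using Qbound[OF t] sq[of "z t"] sq[of "w t"] by (auto simp: M_def Q_def) (smt (verit) zero_le_power2)+
  have eE: "\<bar>e t\<bar> \<le> E" if t: "0 < t" "t \<le> a" for t
  proof -
    have "\<bar>e t\<bar> \<le> K * (\<bar>z t\<bar> + \<bar>w t\<bar> + 1)" using e t a by auto
    also have "\<dots> \<le> E"
      unfolding E_def using zw[OF t] K by (intro mult_left_mono) auto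
    finally show ?thesis .
  qed
  have M0: "0 \<le> M" using zw(1)[of a] a by linarith
  have E0: "0 \<le> E" using eE[of a] a by linarith

  \<comment> \<open>The bound on \<open>z'\<close> is uniform up to 0, so \<open>z\<close> extends
    continuously to the endpoint; the value of the extension is the limit.\<close>
  have "(E / lam)-lipschitz_on {0<..<a} z"
  proof (rule lipschitz_onI)
    fix x y assume xy: "x \<in> {0<..<a}" "y \<in> {0<..<a}"
    have "norm (z x - z y) \<le> E / lam * norm (x - y)"
    proof (rule field_differentiable_bound[where S="{0<..<a}" and f'="\<lambda>t. - e t / lam"])
      show "(z has_field_derivative - e t / lam) (at t within {0<..<a})" if "t \<in> {0<..<a}" for t
        using that a by (intro has_field_derivative_at_within[OF dz]) auto
      show "norm (- e t / lam) \<le> E / lam" if "t \<in> {0<..<a}" for t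
        using eE[of t] that lam by (auto intro!: divide_right_mono)
    qed (use xy in auto)
    then show "dist (z x) (z y) \<le> E / lam * dist x y" by (simp add: dist_norm)
  qed (use E0 lam in auto)
  then have "uniformly_continuous_on {0<..<a} z"
    by (rule lipschitz_on_uniformly_continuous)
  then obtain z0 where "(z \<longlongrightarrow> z0) (at 0 within {0<..<a})"
    by (rule uniformly_continuous_on_extension_at_closure[of _ _ 0]) (use a in auto)
  moreover have "at 0 within {0<..<a} = at_right 0"
    by (rule at_within_nhd[of _ "{..<a}"]) (use a in auto)
  ultimately have zlim: "(z \<longlongrightarrow> z0) (at_right 0)" by simp

  \<comment> \<open>In \<open>P'\<close>, \<open>k <= 2 * lam\<close> keeps the singular part
    \<open>(2 * lam - k) * w^2 / x\<close> nonnegative. With \<open>k < 1\<close> the derivative of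
    \<open>t powr (1 - k)\<close> is positive and carries the same weight
    \<open>t powr (- k)\<close> as the term \<open>2 * w * e\<close>, which
    \<open>A * (1 - k) = 2 * M * E\<close> dominates.\<close>
  define k where "k = min (2 * lam) (1 / 2)"
  have k: "0 < k" "k < 1" "k \<le> 2 * lam" using lam by (auto simp: k_def)
  define A where "A = 2 * M * E / (1 - k)"
  have A: "A * (1 - k) = 2 * M * E" using k by (auto simp: A_def)
  have A0: "0 \<le> A" using M0 E0 k by (auto simp: A_def)
  \<comment> \<open>\<open>P\<close> is nondecreasing: its last term compensates the contribution of \<open>e\<close>.\<close>
  define P where "P t = t powr (- k) * (w t)\<^sup>2 + A * t powr (1 - k)" for t
  \<comment> \<open>The bound on \<open>w\<close> alone gives no decay; the weight
    \<open>t powr (- k)\<close> turns monotonicity of \<open>P\<close> into a rate for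
    \<open>w^2\<close>.\<close>
  have w2: "(w t)\<^sup>2 \<le> P a * t powr k" if t: "0 < t" "t \<le> a" for t
  proof -
    have "P t \<le> P a"
    proof (rule DERIV_nonneg_imp_nondecreasing[OF t(2)])
      fix x assume x: "t \<le> x" "x \<le> a"
      then have x': "0 < x" "x < c" "x \<le> a" using t a by auto
      have pw: "x powr (- k - 1) = x powr (- k) / x"
        using x' by (simp add: powr_diff)
      have "(P has_real_derivative
          - k * x powr (- k - 1) * (w x)\<^sup>2 + x powr (- k) * (2 * w x * (lam * w x / x + e x))
            + A * ((1 - k) * x powr (- k))) (at x)"
        unfolding P_def using x'
        by (auto intro!: derivative_eq_intros dw simp: algebra_simps)
      also have "- k * x powr (- k - 1) * (w x)\<^sup>2 + x powr (- k) * (2 * w x * (lam * w x / x + e x))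
            + A * ((1 - k) * x powr (- k))
          = x powr (- k) * ((2 * lam - k) * (w x)\<^sup>2 / x + (2 * (w x * e x) + A * (1 - k)))"
        using x' unfolding pw by (simp add: field_simps power2_eq_square)
      finally have "(P has_real_derivative
          x powr (- k) * ((2 * lam - k) * (w x)\<^sup>2 / x + (2 * (w x * e x) + A * (1 - k)))) (at x)" .
      moreover have "\<bar>w x * e x\<bar> \<le> M * E"
        unfolding abs_mult using zw[of x] eE[of x] x' M0 by (intro mult_mono) auto
      then have "0 \<le> 2 * (w x * e x) + A * (1 - k)" unfolding A by linarith
      then have "0 \<le> x powr (- k) * ((2 * lam - k) * (w x)\<^sup>2 / x + (2 * (w x * e x) + A * (1 - k)))"
        using k x' by simp
      ultimately show "\<exists>y. (P has_real_derivative y) (at x) \<and> 0 \<le> y" by blast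
    qed
    then have "t powr (- k) * (w t)\<^sup>2 \<le> P a"
      using A0 unfolding P_def by (smt (verit) mult_nonneg_nonneg powr_ge_zero)
    then show ?thesis using t by (simp add: powr_minus field_simps)
  qed
  have "((\<lambda>t. t powr k) \<longlongrightarrow> 0 powr k) (at_right 0)"
    using k by (intro tendsto_powr2 tendsto_const tendsto_ident_at) (auto simp: eventually_at_filter)
  then have "((\<lambda>t. P a * t powr k) \<longlongrightarrow> P a * 0 powr k) (at_right 0)"
    by (rule tendsto_mult_left)
  then have powr_lim: "((\<lambda>t. P a * t powr k) \<longlongrightarrow> 0) (at_right 0)"
    by simp
  have "((\<lambda>t. (w t)\<^sup>2) \<longlongrightarrow> 0) (at_right 0)"
  proof (rule tendsto_sandwich[OF _ _ tendsto_const powr_lim])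
    show "\<forall>\<^sub>F t in at_right 0. (w t)\<^sup>2 \<le> P a * t powr k"
      using eventually_at_right_real[OF a(1)] by eventually_elim (use w2 in auto)
  qed auto
  then have "(w \<longlongrightarrow> 0) (at_right 0)"
    using tendsto_real_sqrt[of "\<lambda>t. (w t)\<^sup>2"] by (auto simp: tendsto_rabs_zero_iff)
  with zlim show ?thesis by blast
qed

section \<open>The singular equation in the distance variable\<close>

text \<open>Dividing by \<open>t powr \<beta>\<close> removes the inverse-square potential, because
  \<beta> is an indicial exponent. What remains is the perturbed Euler system; the coefficient
  \<open>b\<close>, of either sign, enters only through its bound.\<close>

lemma singular_ode_limit:
  fixes f f' f'' b :: "real \<Rightarrow> real"
  assumes "0 < a" and p: "0 < p" "p < 1" and mu: "\<mu> < 1/4" and \<beta>: "\<beta> = 1/2 - sqrt (1/4 - \<mu>)"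
    and df: "\<And>t. 0 < t \<Longrightarrow> t < a \<Longrightarrow> (f has_real_derivative f' t) (at t)"
    and df': "\<And>t. 0 < t \<Longrightarrow> t < a \<Longrightarrow> (f' has_real_derivative f'' t) (at t)"
    and b: "\<And>t. 0 < t \<Longrightarrow> t < a \<Longrightarrow> \<bar>b t\<bar> \<le> B"
    and pos: "\<And>t. 0 < t \<Longrightarrow> t < a \<Longrightarrow> 0 < f t"
    and ode: "\<And>t. 0 < t \<Longrightarrow> t < a \<Longrightarrow> f'' t + b t * f' t + \<mu> / t\<^sup>2 * f t = f t powr p"
  shows "\<exists>v0. ((\<lambda>t. f t / t powr \<beta>) \<longlongrightarrow> v0) (at_right 0)"
proof -
  define lam where "lam = 1 - 2 * \<beta>"
  have lam: "0 < lam" using mu by (simp add: lam_def \<beta>)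
  \<comment> \<open>\<beta> is the smaller root of \<open>x^2 - x + \<mu> = 0\<close>, and
    \<open>lam\<close> is the gap between the two roots.\<close>
  have "(sqrt (1/4 - \<mu>))\<^sup>2 = 1/4 - \<mu>" using mu by simp
  then have \<mu>_eq: "\<mu> = \<beta> - \<beta>\<^sup>2" by (simp add: \<beta> power2_eq_square algebra_simps)
  \<comment> \<open>Staying below 1 makes every nonnegative power of \<open>t\<close> at most
    1.\<close>
  define c where "c = min a 1"
  have c: "0 < c" "c \<le> a" "c \<le> 1" using \<open>0 < a\<close> by (auto simp: c_def)
  have "0 \<le> B" using b[of "a / 2"] \<open>0 < a\<close> by simp
  define v where "v t = f t * t powr (- \<beta>)" for t
  define w where "w t = t powr (1 - \<beta>) * f' t - \<beta> * v t" for t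
  \<comment> \<open>Here \<open>w + \<beta> * v\<close> is \<open>t powr (1 - \<beta>) * f'\<close>,
    so \<open>e\<close> collects the first-order term and the nonlinearity after multiplication by
    \<open>t powr (1 - \<beta>)\<close>.\<close>
  define e where "e t = - b t * (w t + \<beta> * v t) + t powr (1 - \<beta>) * f t powr p" for t
  define z where "z t = v t - w t / lam" for t
  define K where "K = (B + B * \<bar>\<beta>\<bar> + 1) * (1 + 1 / lam)"
  have dv: "(v has_real_derivative w t / t) (at t)" if t: "0 < t" "t < c" for t
  proof -
    have "(v has_real_derivative f' t * t powr (- \<beta>) + f t * (- \<beta> * t powr (- \<beta> - 1))) (at t)"
      unfolding v_def using t c by (auto intro!: derivative_eq_intros df)
    moreover have "t powr (- \<beta> - 1) = t powr (- \<beta>) / t" "t powr (1 - \<beta>) = t * t powr (- \<beta>)"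
      using t by (auto simp: powr_diff powr_minus field_simps)
    ultimately show ?thesis
      using t by (simp add: w_def v_def field_simps)
  qed
  have dw: "(w has_real_derivative lam * w t / t + e t) (at t)" if t: "0 < t" "t < c" for t
  proof -
    have ta: "t < a" using t c by simp
    have pw: "t powr (1 - \<beta>) = t * t powr (- \<beta>)"
      using t by (auto simp: powr_diff powr_minus field_simps)
    have "(w has_real_derivative
        (1 - \<beta>) * t powr (- \<beta>) * f' t + t powr (1 - \<beta>) * f'' t - \<beta> * (w t / t)) (at t)"
      unfolding w_def[abs_def] using t ta
      by (auto intro!: derivative_eq_intros df' dv simp: w_def)
    moreover have f'': "f'' t = f t powr p - b t * f' t - (\<beta> - \<beta>\<^sup>2) / t\<^sup>2 * f t"
      using ode[OF t(1) ta] \<mu>_eq by simp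
    \<comment> \<open>The terms in \<open>v / t\<close> cancel since
      \<open>\<mu> = \<beta> - \<beta>^2\<close>, and \<open>w / t\<close> keeps the coefficient
      \<open>(1 - \<beta>) - \<beta> = lam\<close>.\<close>
    have "(1 - \<beta>) * t powr (- \<beta>) * f' t + t powr (1 - \<beta>) * f'' t - \<beta> * (w t / t)
        = lam * w t / t + e t"
      unfolding f'' e_def w_def v_def lam_def pw using t
      by (simp add: field_simps power2_eq_square)
    ultimately show ?thesis by simp
  qed
  have dz: "(z has_real_derivative - e t / lam) (at t)" if t: "0 < t" "t < c" for t
  proof -
    have "(z has_real_derivative w t / t - (lam * w t / t + e t) / lam) (at t)"
      unfolding z_def using t lam by (auto intro!: derivative_eq_intros dv dw)
    then show ?thesis using lam t by (simp add: field_simps)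
  qed
  have e: "\<bar>e t\<bar> \<le> K * (\<bar>z t\<bar> + \<bar>w t\<bar> + 1)" if t: "0 < t" "t < c" for t
  proof -
    have ta: "t < a" "t \<le> 1" using t c by auto
    have v0: "0 < v t" using pos[OF t(1) ta(1)] t by (simp add: v_def)
    have fv: "f t = v t * t powr \<beta>" using t by (simp add: v_def powr_minus field_simps)
    have vp: "v t powr p \<le> 1 + v t"
    proof (cases "v t \<le> 1")
      case True
      then have "v t powr p \<le> 1 powr p" using v0 p by (intro powr_mono2) auto
      then show ?thesis using v0 by simp
    next
      case False
      then have "v t powr p \<le> v t powr 1" using p by (intro powr_mono) auto
      then show ?thesis using v0 by simp
    qed
    \<comment> \<open>This says that the exponent of \<open>t\<close> in the rescaled nonlinearity
      is nonnegative; if \<beta> is positive, it is below 1/2.\<close>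
    have "\<beta> * (1 - p) \<le> 1"
    proof (cases "\<beta> \<le> 0")
      case True
      then show ?thesis using p mult_nonpos_nonneg[of \<beta> "1 - p"] by linarith
    next
      case False
      then show ?thesis using p lam mult_mono[of \<beta> 1 "1 - p" 1] by (simp add: lam_def)
    qed
    then have "t powr (1 - \<beta> + \<beta> * p) \<le> 1"
      using t ta by (intro powr_le1) (auto simp: algebra_simps)
    then have "v t powr p * t powr (1 - \<beta> + \<beta> * p) \<le> 1 + v t"
      using mult_mono[OF vp, of "t powr (1 - \<beta> + \<beta> * p)" 1] v0 by simp
    moreover have "t powr (1 - \<beta>) * f t powr p = v t powr p * t powr (1 - \<beta> + \<beta> * p)"
      unfolding fv using v0 by (simp add: powr_mult powr_powr powr_add mult_ac)
    ultimately have h: "\<bar>t powr (1 - \<beta>) * f t powr p\<bar> \<le> 1 + v t"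
      by (simp add: abs_mult)
    have "\<bar>b t * (w t + \<beta> * v t)\<bar> \<le> B * (\<bar>w t\<bar> + \<bar>\<beta>\<bar> * v t)"
      unfolding abs_mult using b[OF t(1) ta(1)] \<open>0 \<le> B\<close> v0 
      by (intro mult_mono order.trans[OF abs_triangle_ineq]) (auto simp: abs_mult)
    with h have "\<bar>e t\<bar> \<le> B * (\<bar>w t\<bar> + \<bar>\<beta>\<bar> * v t) + (1 + v t)"
      unfolding e_def by linarith
    also have "\<dots> \<le> (B + B * \<bar>\<beta>\<bar> + 1) * (v t + \<bar>w t\<bar> + 1)"
      using \<open>0 \<le> B\<close> v0 by (simp add: algebra_simps)
    \<comment> \<open>Passing from \<open>v\<close> to \<open>z\<close> through
      \<open>v = z + w / lam\<close> costs the factor \<open>1 + 1 / lam\<close>.\<close>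
    also have "\<dots> \<le> (B + B * \<bar>\<beta>\<bar> + 1) * ((1 + 1 / lam) * (\<bar>z t\<bar> + \<bar>w t\<bar> + 1))"
    proof (rule mult_left_mono)
      have "v t = z t + w t / lam" by (simp add: z_def)
      then have "v t \<le> \<bar>z t\<bar> + \<bar>w t\<bar> / lam"
        using lam divide_right_mono[OF abs_ge_self, of lam "w t"] abs_ge_self[of "z t"] by linarith
      moreover have "0 \<le> \<bar>z t\<bar> / lam" "0 \<le> 1 / lam" using lam by auto
      moreover have "(1 + 1 / lam) * (\<bar>z t\<bar> + \<bar>w t\<bar> + 1)
          = \<bar>z t\<bar> + \<bar>w t\<bar> + 1 + (\<bar>z t\<bar> / lam + \<bar>w t\<bar> / lam + 1 / lam)"
        by (simp add: algebra_simps)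
      ultimately show "v t + \<bar>w t\<bar> + 1 \<le> (1 + 1 / lam) * (\<bar>z t\<bar> + \<bar>w t\<bar> + 1)"
        by linarith
    qed (use \<open>0 \<le> B\<close> in auto)
    finally show ?thesis by (simp add: K_def mult.assoc)
  qed
  obtain z0 where z0: "(z \<longlongrightarrow> z0) (at_right 0)" "(w \<longlongrightarrow> 0) (at_right 0)"
    using perturbed_euler_system_limit[OF c(1) lam dz dw e] by blast
  have "((\<lambda>t. z t + w t / lam) \<longlongrightarrow> z0 + 0 / lam) (at_right 0)"
    using lam by (intro tendsto_intros z0) auto
  moreover have "z t + w t / lam = f t / t powr \<beta>" for t
    by (simp add: z_def v_def powr_minus divide_inverse)
  ultimately show ?thesis by auto
qed

section \<open>Radial functions and their Laplacian\<close>

lemma C2_on_subset: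
  assumes "C2_on S f" "T \<subseteq> S"
  shows "C2_on T f"
proof -
  have "C1_on T g" if "C1_on S g" for g
    using that assms(2) unfolding C1_on_def by (blast intro: continuous_on_subset)
  then show ?thesis
    using assms(1) unfolding C2_on_def by blast
qed

lemma norm_add_Basis:
  assumes "e \<in> Basis" "i \<in> Basis" "i \<noteq> e"
  shows "norm (r *\<^sub>R e + t *\<^sub>R i) = sqrt (r\<^sup>2 + t\<^sup>2)"
  using assms by (simp add: norm_eq_sqrt_inner inner_add inner_Basis power2_eq_square algebra_simps)

text \<open>Smoothness is given for the function on space, so the regularity of \<open>u\<close> has
  to be recovered. On the ray through \<open>e\<close> the norm is the parameter itself, so the
  partial derivatives along \<open>e\<close> are those of \<open>u\<close>. Each of the other
  \<open>DIM('a) - 1\<close> directions contributes \<open>u' / r\<close>.\<close>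

lemma
  fixes u :: "real \<Rightarrow> real" and e :: "'a::euclidean_space"
  assumes C2: "C2_on (annulus a b) (\<lambda>x::'a. u (norm x))" and e: "e \<in> Basis"
    and "0 \<le> a" and r: "a < r" "r < b"
  shows radial_C2_deriv: "(u has_real_derivative deriv u r) (at r)"
    and radial_C2_deriv2: "(deriv u has_real_derivative deriv (deriv u) r) (at r)"
    and laplacian_radial: "laplacian (\<lambda>x::'a. u (norm x)) (r *\<^sub>R e)
      = deriv (deriv u) r + (real DIM('a) - 1) / r * deriv u r"
proof -
  let ?U = "\<lambda>x::'a. u (norm x)"
  let ?D = "partial_deriv e ?U"
  have norm_e: "norm (x *\<^sub>R e) = x" if "a < x" for x
    using that e \<open>0 \<le> a\<close> by simp
  have ray: "x *\<^sub>R e \<in> annulus a b" if "a < x" "x < b" for x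
    using that norm_e by (simp add: annulus_def)
  have near: "\<forall>\<^sub>F y in nhds x. a < y \<and> y < b" if "a < x" "x < b" for x
    using that eventually_nhds_in_open[of "{a<..<b}" x] by simp
  \<comment> \<open>Partial derivatives are derivatives at 0 of a translate; this turns them into
    derivatives in the radius.\<close>
  have shift: "((\<lambda>t. g (x *\<^sub>R e + t *\<^sub>R e)) has_real_derivative d) (at 0)
      \<longleftrightarrow> ((\<lambda>y. g (y *\<^sub>R e)) has_real_derivative d) (at x)" for g :: "'a \<Rightarrow> real" and x d
    using DERIV_shift[of "\<lambda>y. g (y *\<^sub>R e)" d 0 x] by (simp add: scaleR_left_distrib add.commute)
  have du: "(u has_real_derivative ?D (x *\<^sub>R e)) (at x)" if x: "a < x" "x < b" for x
  proof -
    have "(\<lambda>t. ?U (x *\<^sub>R e + t *\<^sub>R e)) field_differentiable at 0"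
      using C2 e ray[OF x] unfolding C2_on_def C1_on_def by blast
    then have "((\<lambda>t. ?U (x *\<^sub>R e + t *\<^sub>R e)) has_real_derivative ?D (x *\<^sub>R e)) (at 0)"
      unfolding partial_deriv_def by (simp add: DERIV_deriv_iff_field_differentiable)
    then have "((\<lambda>y. ?U (y *\<^sub>R e)) has_real_derivative ?D (x *\<^sub>R e)) (at x)"
      by (rule shift[of ?U, THEN iffD1])
    moreover have "\<forall>\<^sub>F y in nhds x. ?U (y *\<^sub>R e) = u y"
      using near[OF x] by eventually_elim (simp only: norm_e)
    ultimately show ?thesis
      by (rule DERIV_cong_ev[OF refl _ refl, THEN iffD1, rotated])
  qed
  then have deriv_u: "deriv u x = ?D (x *\<^sub>R e)" if "a < x" "x < b" for x
    using that by (blast intro: DERIV_imp_deriv)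
  show "(u has_real_derivative deriv u r) (at r)"
    using du[OF r] deriv_u[OF r] by simp
  have "(\<lambda>t. ?D (r *\<^sub>R e + t *\<^sub>R e)) field_differentiable at 0"
    using C2 e ray[OF r] unfolding C2_on_def C1_on_def by blast
  then have "((\<lambda>t. ?D (r *\<^sub>R e + t *\<^sub>R e)) has_real_derivative partial_deriv e ?D (r *\<^sub>R e)) (at 0)"
    unfolding partial_deriv_def[of e ?D] by (simp add: DERIV_deriv_iff_field_differentiable)
  then have "((\<lambda>y. ?D (y *\<^sub>R e)) has_real_derivative partial_deriv e ?D (r *\<^sub>R e)) (at r)"
    by (rule shift[of ?D, THEN iffD1])
  moreover have "\<forall>\<^sub>F y in nhds r. ?D (y *\<^sub>R e) = deriv u y"
    using near[OF r] by eventually_elim (simp only: deriv_u)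
  ultimately have ddu: "(deriv u has_real_derivative partial_deriv e ?D (r *\<^sub>R e)) (at r)"
    by (rule DERIV_cong_ev[OF refl _ refl, THEN iffD1, rotated])
  then have ee: "partial_deriv e ?D (r *\<^sub>R e) = deriv (deriv u) r"
    by (simp add: DERIV_imp_deriv)
  show "(deriv u has_real_derivative deriv (deriv u) r) (at r)"
    using ddu ee by simp
  have "0 < r" using r \<open>0 \<le> a\<close> by simp
  have ii: "partial_deriv i (partial_deriv i ?U) (r *\<^sub>R e) = deriv u r / r"
    if i: "i \<in> Basis" "i \<noteq> e" for i
  proof -
    let ?q = "\<lambda>t. sqrt (r\<^sup>2 + t\<^sup>2)"
    have norm_i: "norm (r *\<^sub>R e + t *\<^sub>R i) = ?q t" for t
      using norm_add_Basis[OF e i] .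
    have q: "?q \<midarrow>0\<rightarrow> r" "0 < ?q t" for t
    proof -
      have "?q \<midarrow>0\<rightarrow> sqrt (r\<^sup>2 + 0\<^sup>2)" by (intro tendsto_intros)
      then show "?q \<midarrow>0\<rightarrow> r" using \<open>0 < r\<close> by simp
      show "0 < ?q t" using \<open>0 < r\<close> by (simp add: add_pos_nonneg)
    qed
    have near_q: "\<forall>\<^sub>F t in at 0. a < ?q t \<and> ?q t < b"
      using order_tendstoD[OF q(1)] r by (auto intro: eventually_conj)
    have Di: "partial_deriv i ?U (r *\<^sub>R e + t *\<^sub>R i) = deriv u (?q t) / ?q t * t"
      if t: "a < ?q t" "?q t < b" for t
    proof -
      have "((\<lambda>t. u (?q t)) has_real_derivative deriv u (?q t) * (t / ?q t)) (at t)"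
      proof (rule DERIV_chain2[where f=u and g="?q"])
        show "(u has_real_derivative deriv u (?q t)) (at (?q t))"
          using du[OF t] deriv_u[OF t] by simp
        show "(?q has_real_derivative t / ?q t) (at t)"
          using q(2)[of t] by (auto intro!: derivative_eq_intros simp: field_simps)
      qed
      then have "((\<lambda>s. u (?q (s + t))) has_real_derivative deriv u (?q t) * (t / ?q t)) (at 0)"
        using DERIV_shift[of "\<lambda>t. u (?q t)" _ 0 t] by simp
      moreover have "?U (r *\<^sub>R e + t *\<^sub>R i + s *\<^sub>R i) = u (?q (s + t))" for s
        using norm_i[of "t + s"] by (simp add: scaleR_left_distrib add.assoc add.commute[of s])
      ultimately show ?thesis
        unfolding partial_deriv_def by (simp add: DERIV_imp_deriv)
    qed
    \<comment> \<open>The first partial derivative is \<open>t\<close> times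
      \<open>deriv u (?q t) / ?q t\<close> and vanishes at \<open>t = 0\<close>. Its difference
      quotient is therefore exactly this factor, and continuity of \<open>deriv u\<close> gives the
      limit.\<close>
    have "((\<lambda>t. deriv u (?q t) / ?q t) \<longlongrightarrow> deriv u r / r) (at 0)"
      using \<open>0 < r\<close>
      by (intro tendsto_divide[OF isCont_tendsto_compose[OF DERIV_isCont[OF ddu] q(1)] q(1)]) simp
    moreover have "\<forall>\<^sub>F t in at 0. deriv u (?q t) / ?q t
        = (partial_deriv i ?U (r *\<^sub>R e + t *\<^sub>R i) - partial_deriv i ?U (r *\<^sub>R e + 0 *\<^sub>R i)) / (t - 0)"
    proof -
      have Di0: "partial_deriv i ?U (r *\<^sub>R e + 0 *\<^sub>R i) = 0"
        using Di[of 0] r \<open>0 < r\<close> by simp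
      have "\<forall>\<^sub>F t in at 0. t \<noteq> (0::real)" by (simp add: eventually_at_filter)
      then show ?thesis
        using near_q by eventually_elim (simp only: Di Di0, simp)
    qed
    ultimately have "((\<lambda>t. partial_deriv i ?U (r *\<^sub>R e + t *\<^sub>R i)) has_real_derivative deriv u r / r) (at 0)"
      unfolding has_field_derivative_iff by (rule Lim_transform_eventually)
    then show ?thesis
      unfolding partial_deriv_def[of i "partial_deriv i ?U"] by (rule DERIV_imp_deriv)
  qed
  have "laplacian ?U (r *\<^sub>R e)
      = partial_deriv e ?D (r *\<^sub>R e) + (\<Sum>i\<in>Basis - {e}. deriv u r / r)"
    unfolding laplacian_def sum.remove[OF finite_Basis e] using ii by simp
  also have "(\<Sum>i\<in>Basis - {e}. deriv u r / r) = (real DIM('a) - 1) / r * deriv u r"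
    using e by (simp add: card_Diff_singleton of_nat_diff Suc_leI DIM_positive)
  finally show "laplacian ?U (r *\<^sub>R e) = deriv (deriv u) r + (real DIM('a) - 1) / r * deriv u r"
    by (simp only: ee)
qed

section \<open>Distance to the boundary and reduction to one variable along a ray\<close>

lemma frontier_annulus_norm:
  assumes "x \<in> frontier (annulus r R)"
  shows "norm x = r \<or> norm x = R"
proof -
  have "open (annulus r R :: 'a set)"
    unfolding annulus_def by (intro open_Collect_conj open_Collect_less continuous_intros)
  moreover have "closed {x::'a. r \<le> norm x \<and> norm x \<le> R}"
    by (intro closed_Collect_conj closed_Collect_le continuous_intros)
  then have "closure (annulus r R :: 'a set) \<subseteq> {x. r \<le> norm x \<and> norm x \<le> R}"
    by (rule closure_minimal[rotated]) (auto simp: annulus_def)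
  ultimately show ?thesis
    using assms by (auto simp: frontier_def interior_open) (auto simp: annulus_def)
qed

lemma frontier_ball_norm:
  assumes "x \<in> frontier (ball (0::'a::euclidean_space) R)"
  shows "norm x = R"
  using assms by (cases "0 < R") (auto simp: not_less ball_empty)

text \<open>Supplies the boundary point on the ray, which later realises the distance: it is a limit
  of points of \<Omega> without belonging to \<Omega>.\<close>

lemma ray_in_frontier:
  fixes e :: "'a::real_normed_vector"
  assumes "\<And>t. 0 < t \<Longrightarrow> t < a \<Longrightarrow> (s + \<sigma> * t) *\<^sub>R e \<in> \<Omega>" and "0 < a" and "s *\<^sub>R e \<notin> \<Omega>"
  shows "s *\<^sub>R e \<in> frontier \<Omega>"
proof -
  have "((\<lambda>t. (s + \<sigma> * t) *\<^sub>R e) \<longlongrightarrow> (s + \<sigma> * 0) *\<^sub>R e) (at_right 0)"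
    by (intro tendsto_intros)
  moreover have "\<forall>\<^sub>F t in at_right 0. (s + \<sigma> * t) *\<^sub>R e \<in> closure \<Omega>"
    using eventually_at_right_real[OF \<open>0 < a\<close>]
    by eventually_elim (use assms(1) closure_subset in auto)
  ultimately have "(s + \<sigma> * 0) *\<^sub>R e \<in> closure \<Omega>"
    by (intro Lim_in_closed_set[OF closed_closure]) auto
  then show ?thesis
    using assms(3) interior_subset by (auto simp: frontier_def)
qed

text \<open>The boundary point on the ray gives the upper bound; the reverse triangle inequality
  reduces the lower bound to a comparison of norms.\<close>

lemma infdist_ray:
  fixes e :: "'a::real_normed_vector"
  assumes "norm e = 1" "s *\<^sub>R e \<in> F" "0 \<le> r" and "\<And>y. y \<in> F \<Longrightarrow> \<bar>r - s\<bar> \<le> \<bar>r - norm y\<bar>"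
  shows "infdist (r *\<^sub>R e) F = \<bar>r - s\<bar>"
proof (rule antisym)
  have "dist (r *\<^sub>R e) (s *\<^sub>R e) = \<bar>r - s\<bar>"
    using assms(1) by (simp add: dist_norm flip: scaleR_left_diff_distrib)
  then show "infdist (r *\<^sub>R e) F \<le> \<bar>r - s\<bar>"
    using infdist_le[OF assms(2), of "r *\<^sub>R e"] by argo
  have "\<bar>r - s\<bar> \<le> dist (r *\<^sub>R e) y" if "y \<in> F" for y
    using assms(4)[OF that] norm_triangle_ineq3[of "r *\<^sub>R e" y] assms(1,3) by (simp add: dist_norm)
  moreover have "F \<noteq> {}" using assms(2) by auto
  ultimately show "\<bar>r - s\<bar> \<le> infdist (r *\<^sub>R e) F"
    by (auto simp: infdist_def intro!: cINF_greatest)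
qed

text \<open>The sign \<open>\<sigma>\<close> is the direction into the domain: \<open>-1\<close> at an outer and \<open>1\<close> at an inner boundary.\<close>

lemma positive_radial_solution_limit:
  fixes \<Omega> :: "'a::euclidean_space set" and u :: "real \<Rightarrow> real"
  assumes p: "0 < p" "p < 1" and mu: "\<mu> < 1/4" and \<beta>: "\<beta> = 1/2 - sqrt (1/4 - \<mu>)"
    and \<sigma>: "\<sigma> = 1 \<or> \<sigma> = -1" and c: "0 < c" "c \<le> s / 2"
    and inside: "\<And>(x::'a) t. 0 < t \<Longrightarrow> t < c \<Longrightarrow> norm x = s + \<sigma> * t \<Longrightarrow> x \<in> \<Omega>"
    and outside: "\<And>x::'a. norm x = s \<Longrightarrow> x \<notin> \<Omega>"
    and frontier: "\<And>y t. y \<in> frontier \<Omega> \<Longrightarrow> 0 < t \<Longrightarrow> t < c \<Longrightarrow> t \<le> \<bar>s + \<sigma> * t - norm y\<bar>"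
    and sol: "positive_radial_solution_up_to \<Omega> s \<mu> p u"
  shows "\<exists>v0. ((\<lambda>t. u (s + \<sigma> * t) / t powr \<beta>) \<longlongrightarrow> v0) (at_right 0)"
proof -
  let ?U = "\<lambda>x::'a. u (norm x)"
  obtain d where "0 < d" and S: "solution_on \<Omega> {x\<in>\<Omega>. \<bar>norm x - s\<bar> < d} \<mu> p ?U"
      and pos: "\<And>x. x \<in> \<Omega> \<Longrightarrow> \<bar>norm x - s\<bar> < d \<Longrightarrow> 0 < ?U x"
    using sol unfolding positive_radial_solution_up_to_def Let_def by blast
  define a where "a = min c d"
  have a: "0 < a" "a \<le> c" "a \<le> d" using c \<open>0 < d\<close> by (auto simp: a_def)
  \<comment> \<open>Ordering the two radii lets one annulus serve both signs of \<sigma>.\<close>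
  define l h where "l = min s (s + \<sigma> * a)" and "h = max s (s + \<sigma> * a)"
  have l0: "0 \<le> l" using \<sigma> a c by (auto simp: l_def)
  have lh: "l < s + \<sigma> * t" "s + \<sigma> * t < h" if "0 < t" "t < a" for t
    using \<sigma> that by (auto simp: l_def h_def)
  have in_S: "x \<in> \<Omega> \<and> \<bar>norm x - s\<bar> < d" if "norm x = s + \<sigma> * t" "0 < t" "t < a" for x :: 'a and t
    using inside[of t x] that \<sigma> a by auto
  have "annulus l h \<subseteq> {x\<in>\<Omega>. \<bar>norm x - s\<bar> < d}"
  proof
    fix x :: 'a
    assume "x \<in> annulus l h"
    then show "x \<in> {x\<in>\<Omega>. \<bar>norm x - s\<bar> < d}"
      \<comment> \<open>Since \<open>\<sigma> * \<sigma> = 1\<close>, this witness inverts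
        \<open>t \<mapsto> s + \<sigma> * t\<close>.\<close>
      using in_S[of x "\<sigma> * (norm x - s)"] \<sigma> a by (auto simp: annulus_def l_def h_def)
  qed
  then have C2: "C2_on (annulus l h) ?U"
    using S C2_on_subset unfolding solution_on_def by blast
  obtain e :: 'a where e: "e \<in> Basis" using nonempty_Basis by blast
  have norm_e: "norm ((s + \<sigma> * t) *\<^sub>R e) = s + \<sigma> * t" if "0 < t" "t < a" for t
    using lh(1)[OF that] l0 e by simp
  have ds: "((\<lambda>t. s + \<sigma> * t) has_real_derivative \<sigma>) (at t)" for t
    by (auto intro!: derivative_eq_intros)
  have \<sigma>2: "\<sigma> * \<sigma> = 1" using \<sigma> by auto
  have s_e: "s *\<^sub>R e \<in> frontier \<Omega>"
  proof (rule ray_in_frontier[OF _ a(1)])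
    show "(s + \<sigma> * t) *\<^sub>R e \<in> \<Omega>" if "0 < t" "t < a" for t
      using in_S[OF norm_e[OF that] that] by blast
    show "s *\<^sub>R e \<notin> \<Omega>" using outside e c by simp
  qed
  \<comment> \<open>Each derivative in \<open>t\<close> brings a factor \<sigma>: one stays in
    \<open>f'\<close>, two cancel in \<open>f''\<close>. The \<sigma> in \<open>b\<close> makes
    \<open>b * f'\<close> the original first-order term.\<close>
  define f' where "f' t = \<sigma> * deriv u (s + \<sigma> * t)" for t
  define f'' where "f'' t = deriv (deriv u) (s + \<sigma> * t)" for t
  define b where "b t = \<sigma> * ((real DIM('a) - 1) / (s + \<sigma> * t))" for t
  show ?thesis
  proof (rule singular_ode_limit[OF a(1) p mu \<beta>])
    fix t assume t: "0 < t" "t < a"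
    show "((\<lambda>t. u (s + \<sigma> * t)) has_real_derivative f' t) (at t)"
      using DERIV_chain2[OF radial_C2_deriv[OF C2 e l0 lh[OF t]] ds]
      by (simp add: f'_def mult.commute)
    show "(f' has_real_derivative f'' t) (at t)"
      using DERIV_cmult[OF DERIV_chain2[OF radial_C2_deriv2[OF C2 e l0 lh[OF t]] ds], of \<sigma>] \<sigma>
      by (auto simp: f'_def[abs_def] f''_def)
    \<comment> \<open>As \<open>t < c \<le> s / 2\<close>, the radius stays at least
      \<open>s / 2\<close>, away from the singularity of \<open>1 / r\<close>.\<close>
    show "\<bar>b t\<bar> \<le> (real DIM('a) - 1) / (s / 2)"
    proof -
      have "s / 2 \<le> s + \<sigma> * t" using \<sigma> t a c by auto
      moreover have "1 \<le> real DIM('a)" using DIM_positive[where 'a='a] by linarith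
      ultimately have "(real DIM('a) - 1) / (s + \<sigma> * t) \<le> (real DIM('a) - 1) / (s / 2)"
        and "0 \<le> (real DIM('a) - 1) / (s + \<sigma> * t)"
        using c by (intro divide_left_mono mult_pos_pos divide_nonneg_pos; linarith)+
      moreover have "\<bar>b t\<bar> = \<bar>(real DIM('a) - 1) / (s + \<sigma> * t)\<bar>"
        unfolding b_def abs_mult using \<sigma> by auto
      ultimately show ?thesis by linarith
    qed
    show "0 < u (s + \<sigma> * t)"
      using pos in_S[OF norm_e[OF t] t] norm_e[OF t] by metis
    have "infdist ((s + \<sigma> * t) *\<^sub>R e) (frontier \<Omega>) = \<bar>s + \<sigma> * t - s\<bar>"
    proof (rule infdist_ray[OF _ s_e])
      show "0 \<le> s + \<sigma> * t" using lh(1)[OF t] l0 by simp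
      show "\<bar>s + \<sigma> * t - s\<bar> \<le> \<bar>s + \<sigma> * t - norm y\<bar>" if "y \<in> frontier \<Omega>" for y
        using frontier[OF that, of t] t a \<sigma> by auto
    qed (use e in simp)
    then have "infdist ((s + \<sigma> * t) *\<^sub>R e) (frontier \<Omega>) = t"
      using \<sigma> t by auto
    then have "laplacian ?U ((s + \<sigma> * t) *\<^sub>R e) + \<mu> / t\<^sup>2 * u (s + \<sigma> * t) = u (s + \<sigma> * t) powr p"
      using S in_S[OF norm_e[OF t] t] norm_e[OF t] unfolding solution_on_def by fastforce
    moreover have "b t * f' t = (\<sigma> * \<sigma>) * ((real DIM('a) - 1) / (s + \<sigma> * t) * deriv u (s + \<sigma> * t))"
      unfolding b_def f'_def by (simp only: mult_ac)
    ultimately show "f'' t + b t * f' t + \<mu> / t\<^sup>2 * u (s + \<sigma> * t) = u (s + \<sigma> * t) powr p"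
      unfolding laplacian_radial[OF C2 e l0 lh[OF t]] f''_def \<sigma>2 by simp
  qed
qed

section \<open>The outer and inner boundary components\<close>

theorem corollary2p3:
  fixes \<Omega> :: "'a::euclidean_space set"
    and u :: "real \<Rightarrow> real" and p \<mu> \<beta> :: real
  assumes "0 < p" and "p < 1" and "\<mu> < 1/4" and "\<mu> \<noteq> 0"
    and "\<beta> = 1/2 - sqrt (1/4 - \<mu>)"
  shows "(\<forall>R>0. (\<Omega> = ball 0 R \<or> (\<exists>r0. 0 < r0 \<and> r0 < R \<and> \<Omega> = annulus r0 R)) \<longrightarrow>
            positive_radial_solution_up_to \<Omega> R \<mu> p u \<longrightarrow>
            (\<exists>v0::real. ((\<lambda>\<delta>. u (R - \<delta>) / \<delta> powr \<beta>) \<longlongrightarrow> v0) (at_right 0))) \<and>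
         (\<forall>r0 R. 0 < r0 \<longrightarrow> r0 < R \<longrightarrow> \<Omega> = annulus r0 R \<longrightarrow>
            positive_radial_solution_up_to \<Omega> r0 \<mu> p u \<longrightarrow>
            (\<exists>v0::real. ((\<lambda>\<delta>. u (r0 + \<delta>) / \<delta> powr \<beta>) \<longlongrightarrow> v0) (at_right 0)))"
proof (intro conjI allI impI)
  note limit = positive_radial_solution_limit[OF assms(1-3,5)]
  fix R :: real
  assume R: "0 < R" and \<Omega>: "\<Omega> = ball 0 R \<or> (\<exists>r0. 0 < r0 \<and> r0 < R \<and> \<Omega> = annulus r0 R)"
    and sol: "positive_radial_solution_up_to \<Omega> R \<mu> p u"
  have "\<exists>v0. ((\<lambda>t. u (R + -1 * t) / t powr \<beta>) \<longlongrightarrow> v0) (at_right 0)"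
    using \<Omega>
  proof (elim disjE exE conjE)
    assume \<Omega>: "\<Omega> = ball 0 R"
    show ?thesis
      by (rule limit[where c="R / 2", OF _ _ _ _ _ _ sol])
        (use R in \<open>auto simp: \<Omega> dest: frontier_ball_norm\<close>)
  next
    fix r0 assume r0: "0 < r0" "r0 < R" and \<Omega>: "\<Omega> = annulus r0 R"
    show ?thesis
      \<comment> \<open>Within half the width of the annulus the outer sphere is the nearest
        boundary component; \<open>R / 2\<close> keeps the radius away from 0.\<close>
      by (rule limit[where c="min (R / 2) ((R - r0) / 2)", OF _ _ _ _ _ _ sol])
        (use r0 R in \<open>auto simp: \<Omega> dest!: frontier_annulus_norm, auto simp: annulus_def\<close>)
  qed
  then show "\<exists>v0. ((\<lambda>\<delta>. u (R - \<delta>) / \<delta> powr \<beta>) \<longlongrightarrow> v0) (at_right 0)"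
    by simp
next
  note limit = positive_radial_solution_limit[OF assms(1-3,5)]
  fix r0 R :: real
  assume r0: "0 < r0" "r0 < R" and \<Omega>: "\<Omega> = annulus r0 R"
    and sol: "positive_radial_solution_up_to \<Omega> r0 \<mu> p u"
  have "\<exists>v0. ((\<lambda>t. u (r0 + 1 * t) / t powr \<beta>) \<longlongrightarrow> v0) (at_right 0)"
    by (rule limit[where c="min (r0 / 2) ((R - r0) / 2)", OF _ _ _ _ _ _ sol])
      (use r0 in \<open>auto simp: \<Omega> dest!: frontier_annulus_norm, auto simp: annulus_def\<close>)
  then show "\<exists>v0. ((\<lambda>\<delta>. u (r0 + \<delta>) / \<delta> powr \<beta>) \<longlongrightarrow> v0) (at_right 0)"
    by simp
qed

end
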